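(* Let $f=(f_1,\dots,f_s):\mathbb{R}^n\to\mathbb{R}^s$ be a locally Lipschitz mapping and let $K\subseteq\mathbb{R}^n$ be a nonempty closed set. The following assertions are equivalent: (i) The problem $\mathrm{VOP}(K,f)$ admits a weak Pareto efficient solution. (ii) There exist a nonempty index set $I\subseteq\{1,\dots,s\}$ and $x_0\in K$ such that $f$ is weakly section-bounded from below on $K$ with respect to $I$ and $x_0$, and the inclusion $\widetilde{K}_{\infty,\le f_I(x_0)}(f_I,K_{x_0})\subseteq K_{0,\le f_I(x_0)}(f_I,K_{x_0})$ holds. (iii) There exist a nonempty index set $I\subseteq\{1,\dots,s\}$ and $x_0\in K$ such that $f$ is weakly section-bounded from below on $K$ with respect to $I$ and $x_0$, and the inclusion $K_{\infty,\le f_I(x_0)}(f_I,K_{x_0})\subseteq K_{0,\le f_I(x_0)}(f_I,K_{x_0})$ holds. (iv) There exist a nonempty index set $I\subseteq\{1,\dots,s\}$ and $x_0\in K$ such that $f$ is weakly section-bounded from below on $K$ with respect to $I$ and $x_0$, and the inclusion $T_{\infty,\le f_I(x_0)}(f_I,K_{x_0})\subseteq K_{0,\le f_I(x_0)}(f_I,K_{x_0})$ holds.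
   Context: Inequalities between vectors are componentwise. $\mathrm{VOP}(K,f)$ is the problem of minimizing $f$ over $K$. A point $x^*\in K$ is a weak Pareto efficient solution if there is no $x\in K$ with $f_i(x)<f_i(x^* )$ for all $i=1,\dots,s$. For $I=\{s_1<\dots<s_q\}\subseteq\{1,\dots,s\}$ nonempty, $|I|=q$, put $f_I=(f_{s_1},\dots,f_{s_q})$. For $x_0\in K$ put $K_{x_0}=\{x\in K: f_i(x)\le f_i(x_0),\ i=1,\dots,s\}$ (all $s$ components of $f$ are used). Weak section-boundedness: $f$ is weakly section-bounded from below on $K$ with respect to $I$ and $x_0$ if there is $\bar a\in\mathbb{R}^{|I|}$ with $\{f_I(x): x\in K_{x_0}\}\subseteq \bar a+\mathbb{R}^{|I|}_+$. Normal cones and subdifferentials: for $C\subseteq\mathbb{R}^m$ and $\bar x\in C$, the regular normal cone $\hat N(\bar x;C)$ is the set of $v$ with $\langle v,x-\bar x\rangle\le o(\|x-\bar x\|)$ for $x\in C$, $x\to\bar x$; the limiting normal cone $N(\bar x;C)$ is the set of all limits $v=\lim v_k$ with $v_k\in\hat N(x_k;C)$, $x_k\in C$, $x_k\to\bar x$. For $\varphi:\mathbb{R}^n\to\mathbb{R}$, the (limiting) subdifferential is $\partial\varphi(\bar x)=\{v: (v,-1)\in N((\bar x,\varphi(\bar x));\mathrm{epi}\,\varphi)\}$, where $\mathrm{epi}\,\varphi=\{(x,y):\varphi(x)\le y\}$. For a locally Lipschitz mapping $g=(g_1,\dots,g_m):\mathbb{R}^n\to\mathbb{R}^m$, a nonempty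 closed set $C\subseteq\mathbb{R}^n$ and $y_0\in\mathbb{R}^m$, define for $x\in C$ the extended Rabier function $$\nu_{g,C}(x)=\inf\Big\{\Big\|\sum_{i=1}^m\alpha_iv_i+\omega\Big\| : v_i\in\partial g_i(x),\ \omega\in N(x;C),\ \alpha\in\mathbb{R}^m_+,\ \sum_{i=1}^m\alpha_i=1\Big\},$$ and let the tangency variety $\Gamma(g,C)$ be the set of $x\in C$ for which there exist $v_i\in\partial g_i(x)$ ($i=1,\dots,m$) and $(\alpha,\mu)\in\mathbb{R}^m_+\times\mathbb{R}$ with $\sum_{i=1}^m\alpha_i+|\mu|=1$ and $0\in\sum_{i=1}^m\alpha_iv_i+\mu x+N(x;C)$. Then: $\widetilde K_{\infty,\le y_0}(g,C)$ is the set of $y\in\mathbb{R}^m$ for which there is a sequence $\{x_k\}\subseteq C$ with $g(x_k)\le y_0$ for all $k$, $\|x_k\|\to+\infty$, $g(x_k)\to y$ and $\nu_{g,C}(x_k)\to0$. $K_{\infty,\le y_0}(g,C)$ is defined in the same way with $\nu_{g,C}(x_k)\to0$ replaced by $\|x_k\|\nu_{g,C}(x_k)\to0$. $T_{\infty,\le y_0}(g,C)$ is the set of $y\in\mathbb{R}^m$ for which there is a sequence $\{x_k\}\subseteq\Gamma(g,C)$ with $g(x_k)\le y_0$ for all $k$, $\|x_k\|\to+\infty$ and $g(x_k)\to y$. $K_{0,\le y_0}(g,C)=\{g(x): x\in C,\ g(x)\le y_0,\ \nu_{g,C}(x)=0\}$. In the claim these are used with $g=f_I$ and $C=K_{x_0}$.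 *)

theory Defs
  imports "HOL-Analysis.Analysis"
begin

text \<open>
  The space of vectors with components indexed by a finite index set \<open>I\<close> (the
  \<open>\<real>\<^sup>|\<^sup>I\<^sup>|\<close> of the mathematics) is represented by \<open>I \<rightarrow>\<^sub>E UNIV\<close>, the functions that are
  undefined outside \<open>I\<close>.  A mapping \<open>g\<close> into that space has type \<open>'a \<Rightarrow> 'i \<Rightarrow> real\<close>, and
  the index set is passed explicitly, because in the intended use, \<open>g = f\<^sub>I\<close>, it is
  existentially quantified and therefore cannot be a type.
\<close>

definition locally_lipschitz :: "('a::metric_space \<Rightarrow> 'b::metric_space) \<Rightarrow> bool" where
  "locally_lipschitz f \<longleftrightarrow> (\<forall>x. \<exists>r>0. \<exists>L. L-lipschitz_on (ball x r) f)"

definition weak_Pareto :: "'a set \<Rightarrow> ('a \<Rightarrow> real ^ 's) \<Rightarrow> 'a \<Rightarrow> bool" where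
  "weak_Pareto K f x \<longleftrightarrow> x \<in> K \<and> \<not> (\<exists>z\<in>K. \<forall>i. f z $ i < f x $ i)"

definition subvector :: "('a \<Rightarrow> real ^ 's) \<Rightarrow> 's set \<Rightarrow> 'a \<Rightarrow> 's \<Rightarrow> real" where
  "subvector f I x = (\<lambda>i\<in>I. f x $ i)"

definition section_at :: "'a set \<Rightarrow> ('a \<Rightarrow> real ^ 's) \<Rightarrow> 'a \<Rightarrow> 'a set" where
  "section_at K f x0 = {x \<in> K. \<forall>i. f x $ i \<le> f x0 $ i}"

definition weakly_section_bounded ::
  "'a set \<Rightarrow> ('a \<Rightarrow> real ^ 's) \<Rightarrow> 's set \<Rightarrow> 'a \<Rightarrow> bool" where
  "weakly_section_bounded K f I x0 \<longleftrightarrow>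
     (\<exists>a \<in> I \<rightarrow>\<^sub>E UNIV.
        subvector f I ` section_at K f x0 \<subseteq> {y \<in> I \<rightarrow>\<^sub>E UNIV. \<forall>i\<in>I. a i \<le> y i})"

definition regular_normal_cone :: "'a::euclidean_space \<Rightarrow> 'a set \<Rightarrow> 'a set" where
  "regular_normal_cone p C =
     {v. \<forall>e>0. \<forall>\<^sub>F x in at p within C. v \<bullet> (x - p) \<le> e * norm (x - p)}"

definition normal_cone :: "'a::euclidean_space \<Rightarrow> 'a set \<Rightarrow> 'a set" where
  "normal_cone p C =
     {v. \<exists>x w. (\<forall>k::nat. x k \<in> C \<and> w k \<in> regular_normal_cone (x k) C) \<and>
           x \<longlonglongrightarrow> p \<and> w \<longlonglongrightarrow> v}"

definition subdiff :: "('a::euclidean_space \<Rightarrow> real) \<Rightarrow> 'a \<Rightarrow> 'a set" where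
  "subdiff \<phi> x = {v. (v, -1) \<in> normal_cone (x, \<phi> x) (epigraph UNIV \<phi>)}"

text \<open>
  The infimum is taken in \<open>real\<close>: for locally Lipschitz \<open>g\<close>, finite nonempty \<open>I\<close> and
  \<open>x \<in> C\<close> the set is nonempty, since subdifferentials of locally Lipschitz functions are
  nonempty and normal cones contain \<open>0\<close>.
\<close>

definition rabier ::
  "'i set \<Rightarrow> ('a::euclidean_space \<Rightarrow> 'i \<Rightarrow> real) \<Rightarrow> 'a set \<Rightarrow> 'a \<Rightarrow> real" where
  "rabier I g C x =
     Inf {norm ((\<Sum>i\<in>I. \<alpha> i *\<^sub>R v i) + \<omega>) | \<alpha> v \<omega>.
            (\<forall>i\<in>I. v i \<in> subdiff (\<lambda>z. g z i) x) \<and> \<omega> \<in> normal_cone x C \<and>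
            (\<forall>i\<in>I. 0 \<le> \<alpha> i) \<and> (\<Sum>i\<in>I. \<alpha> i) = 1}"

definition tangency_variety ::
  "'i set \<Rightarrow> ('a::euclidean_space \<Rightarrow> 'i \<Rightarrow> real) \<Rightarrow> 'a set \<Rightarrow> 'a set" where
  "tangency_variety I g C =
     {x \<in> C. \<exists>v \<alpha> \<mu>. (\<forall>i\<in>I. v i \<in> subdiff (\<lambda>z. g z i) x) \<and>
        (\<forall>i\<in>I. 0 \<le> \<alpha> i) \<and> (\<Sum>i\<in>I. \<alpha> i) + \<bar>\<mu>\<bar> = 1 \<and>
        (\<exists>\<omega>\<in>normal_cone x C. (\<Sum>i\<in>I. \<alpha> i *\<^sub>R v i) + \<mu> *\<^sub>R x + \<omega> = 0)}"

definition K_tilde_inf ::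
  "'i set \<Rightarrow> ('a::euclidean_space \<Rightarrow> 'i \<Rightarrow> real) \<Rightarrow> 'a set \<Rightarrow> ('i \<Rightarrow> real) \<Rightarrow> ('i \<Rightarrow> real) set" where
  "K_tilde_inf I g C y0 =
     {y \<in> I \<rightarrow>\<^sub>E UNIV. \<exists>x. (\<forall>k::nat. x k \<in> C \<and> (\<forall>i\<in>I. g (x k) i \<le> y0 i)) \<and>
        filterlim (\<lambda>k. norm (x k)) at_top sequentially \<and>
        (\<forall>i\<in>I. (\<lambda>k. g (x k) i) \<longlonglongrightarrow> y i) \<and>
        (\<lambda>k. rabier I g C (x k)) \<longlonglongrightarrow> 0}"

definition K_inf ::
  "'i set \<Rightarrow> ('a::euclidean_space \<Rightarrow> 'i \<Rightarrow> real) \<Rightarrow> 'a set \<Rightarrow> ('i \<Rightarrow> real) \<Rightarrow> ('i \<Rightarrow> real) set" where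
  "K_inf I g C y0 =
     {y \<in> I \<rightarrow>\<^sub>E UNIV. \<exists>x. (\<forall>k::nat. x k \<in> C \<and> (\<forall>i\<in>I. g (x k) i \<le> y0 i)) \<and>
        filterlim (\<lambda>k. norm (x k)) at_top sequentially \<and>
        (\<forall>i\<in>I. (\<lambda>k. g (x k) i) \<longlonglongrightarrow> y i) \<and>
        (\<lambda>k. norm (x k) * rabier I g C (x k)) \<longlonglongrightarrow> 0}"

definition T_inf ::
  "'i set \<Rightarrow> ('a::euclidean_space \<Rightarrow> 'i \<Rightarrow> real) \<Rightarrow> 'a set \<Rightarrow> ('i \<Rightarrow> real) \<Rightarrow> ('i \<Rightarrow> real) set" where
  "T_inf I g C y0 =
     {y \<in> I \<rightarrow>\<^sub>E UNIV. \<exists>x. (\<forall>k::nat. x k \<in> tangency_variety I g C \<and> (\<forall>i\<in>I. g (x k) i \<le> y0 i)) \<and>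
        filterlim (\<lambda>k. norm (x k)) at_top sequentially \<and>
        (\<forall>i\<in>I. (\<lambda>k. g (x k) i) \<longlonglongrightarrow> y i)}"

definition K_zero ::
  "'i set \<Rightarrow> ('a::euclidean_space \<Rightarrow> 'i \<Rightarrow> real) \<Rightarrow> 'a set \<Rightarrow> ('i \<Rightarrow> real) \<Rightarrow> ('i \<Rightarrow> real) set" where
  "K_zero I g C y0 =
     {g x | x. x \<in> C \<and> (\<forall>i\<in>I. g x i \<le> y0 i) \<and> rabier I g C x = 0}"

end

theory Submission
  imports Defs
begin

text \<open>
  Minimize \<open>\<Sum>\<^bsub>i\<in>I\<^esub> f\<^sub>i + \<delta> ln (1 + \<parallel>x\<parallel>\<^sup>2)\<close> over the section at \<open>x\<^sub>0\<close> and let \<open>\<delta> \<rightarrow> 0\<close>.  If the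
  minimizers have a bounded subsequence, a cluster point minimizes \<open>\<Sum>\<^bsub>i\<in>I\<^esub> f\<^sub>i\<close>.  Otherwise, by
  the Fermat rule, every cluster point of their values under \<open>f\<^sub>I\<close> lies in all three asymptotic
  sets, so the assumed inclusion makes it a value of \<open>f\<^sub>I\<close>, attained at a minimizer of the sum.
  Such a minimizer is weakly Pareto efficient.
  Conversely, from a weak Pareto solution one reaches a section on which \<open>f\<^sub>I\<close> is constant for a
  suitable \<open>I\<close>; then the asymptotic sets contain at most one value, which is critical.
\<close>

subsection \<open>Normal cones and the Fermat rule\<close>

text \<open>At a constrained local minimizer, \<open>G \<bullet> (u - z)\<close> can be negative
  only by the Taylor remainder, which is \<open>o(norm (u - z))\<close>.\<close>

lemma regular_normal_cone_minimizer:
  assumes min: "\<forall>\<^sub>F u in at z within C. h z \<le> h u"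
    and der: "(h has_derivative (\<lambda>u. G \<bullet> u)) (at z within C)"
  shows "- G \<in> regular_normal_cone z C"
  unfolding regular_normal_cone_def mem_Collect_eq
proof (intro allI impI)
  fix e :: real assume "e > 0"
  then have "\<forall>\<^sub>F u in at z within C. norm (h u - h z - G \<bullet> (u - z)) \<le> e * norm (u - z)"
    using der by (simp add: has_derivative_within_alt2)
  with min show "\<forall>\<^sub>F u in at z within C. - G \<bullet> (u - z) \<le> e * norm (u - z)"
    by eventually_elim (simp add: abs_le_iff)
qed

lemma regular_normal_cone_scale:
  assumes "v \<in> regular_normal_cone p C" and "c > 0"
  shows "c *\<^sub>R v \<in> regular_normal_cone p C"
  unfolding regular_normal_cone_def mem_Collect_eq
proof (intro allI impI)
  fix e :: real assume "e > 0"
  then have "\<forall>\<^sub>F x in at p within C. v \<bullet> (x - p) \<le> e / c * norm (x - p)"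
    using assms unfolding regular_normal_cone_def mem_Collect_eq by (meson divide_pos_pos)
  then show "\<forall>\<^sub>F x in at p within C. c *\<^sub>R v \<bullet> (x - p) \<le> e * norm (x - p)"
    by eventually_elim (use \<open>c > 0\<close> in \<open>simp add: field_simps\<close>)
qed

lemma normal_cone_scale:
  assumes "v \<in> normal_cone p C" and "c > 0"
  shows "c *\<^sub>R v \<in> normal_cone p C"
proof -
  obtain x w where "\<forall>k::nat. x k \<in> C \<and> w k \<in> regular_normal_cone (x k) C"
    and "x \<longlonglongrightarrow> p" and "w \<longlonglongrightarrow> v"
    using assms by (auto simp: normal_cone_def)
  then have "\<forall>k. x k \<in> C \<and> c *\<^sub>R w k \<in> regular_normal_cone (x k) C"
    and "(\<lambda>k. c *\<^sub>R w k) \<longlonglongrightarrow> c *\<^sub>R v"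
    using \<open>c > 0\<close> by (auto intro: regular_normal_cone_scale tendsto_intros)
  with \<open>x \<longlonglongrightarrow> p\<close> show ?thesis
    unfolding normal_cone_def mem_Collect_eq by (intro exI[of _ x] exI[of _ "\<lambda>k. c *\<^sub>R w k"]) auto
qed

text \<open>Dropping an initial segment turns eventual membership into membership for all
  \<open>k\<close>; the Fermat rule delivers its normals only for large \<open>k\<close>.\<close>

lemma normal_coneI:
  assumes ev: "\<forall>\<^sub>F k in sequentially. x k \<in> C \<and> w k \<in> regular_normal_cone (x k) C"
    and "x \<longlonglongrightarrow> p" and "w \<longlonglongrightarrow> v"
  shows "v \<in> normal_cone p C"
proof -
  obtain N where "\<And>k. k \<ge> N \<Longrightarrow> x k \<in> C \<and> w k \<in> regular_normal_cone (x k) C"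
    using ev by (auto simp: eventually_sequentially)
  then show ?thesis
    unfolding normal_cone_def mem_Collect_eq
    by (intro exI[of _ "\<lambda>k. x (k + N)"] exI[of _ "\<lambda>k. w (k + N)"])
      (use assms(2,3) in \<open>auto intro: LIMSEQ_ignore_initial_segment\<close>)
qed

text \<open>The local minimum of \<open>\<phi> + h\<close> becomes a minimum over the epigraph of
  \<open>h (fst w) + snd w\<close>, which is differentiable at the base point with gradient
  \<open>(G, 1)\<close>.\<close>

lemma regular_normal_cone_epigraph:
  assumes min: "\<forall>\<^sub>F u in nhds x. \<phi> x + h x \<le> \<phi> u + h u"
    and der: "(h has_derivative (\<lambda>u. G \<bullet> u)) (at x)"
  shows "(- G, -1) \<in> regular_normal_cone (x, \<phi> x) (epigraph UNIV \<phi>)"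
proof -
  let ?h = "\<lambda>w. h (fst w) + snd w"
  have "- (G, 1) \<in> regular_normal_cone (x, \<phi> x) (epigraph UNIV \<phi>)"
  proof (rule regular_normal_cone_minimizer[where h = ?h])
    have "filterlim fst (nhds x) (nhds (x, \<phi> x))"
      using tendsto_fst[OF filterlim_ident, of "(x, \<phi> x)"] by simp
    then have "\<forall>\<^sub>F w in nhds (x, \<phi> x). \<phi> x + h x \<le> \<phi> (fst w) + h (fst w)"
      by (rule eventually_compose_filterlim[OF min])
    then show "\<forall>\<^sub>F w in at (x, \<phi> x) within epigraph UNIV \<phi>. ?h (x, \<phi> x) \<le> ?h w"
      unfolding eventually_at_filter by eventually_elim (auto simp: epigraph_def)
    have "(?h has_derivative (\<lambda>w. G \<bullet> fst w + snd w)) (at (x, \<phi> x))"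
      by (intro has_derivative_add has_derivative_snd has_derivative_ident
          has_derivative_compose[OF has_derivative_fst[OF has_derivative_ident], of h])
        (simp add: der)
    then show "(?h has_derivative (\<lambda>w. (G, 1) \<bullet> w)) (at (x, \<phi> x) within epigraph UNIV \<phi>)"
      by (auto simp: inner_prod_def intro: has_derivative_at_withinI)
  qed
  then show ?thesis by simp
qed

lemma has_derivative_power2_norm_diff:
  fixes a :: "'a::euclidean_space"
  shows "((\<lambda>u. (norm (u - a))\<^sup>2) has_derivative (\<lambda>h. (2 *\<^sub>R (z - a)) \<bullet> h)) (at z)"
  unfolding power2_norm_eq_inner
  by (auto intro!: derivative_eq_intros simp: inner_commute inner_simps)

text \<open>
  The proof decouples the summands: each \<open>g\<^sub>i\<close> gets its own variable \<open>X\<^sub>i\<close>, tied to the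
  variable \<open>z \<in> C\<close> of the smooth part by a quadratic penalty.  Comparing a minimizer with
  the constant point \<open>p\<close> bounds the multipliers \<open>2k (z - X\<^sub>i)\<close> by the Lipschitz constant.
\<close>

lemma Fermat_rule_sum:
  fixes g :: "'a::euclidean_space \<Rightarrow> 'i::finite \<Rightarrow> real"
  assumes C: "closed C" "p \<in> C" and r: "r > 0"
    and lip: "\<And>i. i \<in> I \<Longrightarrow> L-lipschitz_on (ball p r) (\<lambda>z. g z i)"
    and der: "\<And>z. (\<psi> has_derivative (\<lambda>h. G z \<bullet> h)) (at z)" and contG: "isCont G p"
    and min: "\<And>u. u \<in> C \<Longrightarrow> u \<in> ball p r \<Longrightarrow>
                 (\<Sum>i\<in>I. g p i) + \<psi> p \<le> (\<Sum>i\<in>I. g u i) + \<psi> u"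
  obtains v \<omega> where "\<And>i. i \<in> I \<Longrightarrow> v i \<in> subdiff (\<lambda>z. g z i) p" and "\<omega> \<in> normal_cone p C"
    and "(\<Sum>i\<in>I. v i) + G p + \<omega> = 0"
proof -
  define P :: "('a ^ 'i) \<times> 'a" where "P = (\<chi> i. p, p)"
  \<comment> \<open>The vector is indexed by the whole type, so coordinates outside \<open>I\<close>
    are frozen at \<open>p\<close>. Radius \<open>r / 2\<close> keeps every coordinate inside
    \<open>ball p r\<close>, where \<open>lip\<close> and \<open>min\<close> apply.\<close>
  define S where "S = {w. snd w \<in> C \<and> (\<forall>i. i \<notin> I \<longrightarrow> fst w $ i = p)} \<inter> cball P (r / 2)"
  \<comment> \<open>The squared distance from \<open>snd w\<close> to \<open>p\<close> makes
    \<open>p\<close> a strict minimizer of the coupled problem and forces \<open>z\<close> to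
    converge to \<open>p\<close>. \<open>Suc k\<close> keeps the penalty weight positive at
    \<open>k = 0\<close>.\<close>
  define F where "F k w = (\<Sum>i\<in>I. g (fst w $ i) i) + \<psi> (snd w) + (norm (snd w - p))\<^sup>2
      + real (Suc k) * (\<Sum>i\<in>I. (norm (fst w $ i - snd w))\<^sup>2)" for k and w :: "('a ^ 'i) \<times> 'a"
  have cont\<psi>: "continuous_on UNIV \<psi>"
    using der by (meson has_derivative_continuous continuous_at_imp_continuous_on)
  have contg: "continuous_on (ball p r) (\<lambda>z. g z i)" if "i \<in> I" for i
    using lip[OF that] by (rule lipschitz_on_continuous_on)
  have comp: "compact S"
  proof -
    have "closed {w :: ('a ^ 'i) \<times> 'a. \<forall>i. i \<notin> I \<longrightarrow> fst w $ i = p}"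
      by (intro closed_Collect_all closed_Collect_imp closed_Collect_eq open_Collect_const
          continuous_intros)
    moreover have "closed {w :: ('a ^ 'i) \<times> 'a. snd w \<in> C}"
      using closed_vimage_snd[OF C(1)] by (simp add: vimage_def)
    ultimately show ?thesis unfolding S_def
      by (intro closed_Int_compact compact_cball closed_Collect_conj)
  qed
  have PS: "P \<in> S" using C r by (auto simp: S_def P_def)
  have in_ball: "snd w \<in> ball p r \<and> (\<forall>i. fst w $ i \<in> ball p r)" if "w \<in> S" for w
  proof -
    have *: "dist P w \<le> r / 2" using that by (simp add: S_def)
    have "dist (snd P) (snd w) \<le> r / 2" using dist_snd_le[of P w] * by linarith
    moreover have "dist (fst P $ i) (fst w $ i) \<le> r / 2" for i
      using dist_vec_nth_le[of "fst P" i "fst w"] dist_fst_le[of P w] * by linarith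
    ultimately show ?thesis using r by (simp add: P_def le_less_trans[of _ "r / 2" r])
  qed
  have contF: "continuous_on S (F k)" for k
  proof -
    have "continuous_on S (\<lambda>w. g (fst w $ i) i)" if "i \<in> I" for i
      using in_ball by (intro continuous_on_compose2[OF contg[OF that]] continuous_intros) auto
    moreover have "continuous_on S (\<lambda>w. \<psi> (snd w))"
      by (intro continuous_on_compose2[OF cont\<psi>] continuous_intros) auto
    ultimately show ?thesis
      unfolding F_def by (intro continuous_intros)
  qed
  have "\<exists>w\<in>S. \<forall>w'\<in>S. F k w \<le> F k w'" for k
    using continuous_attains_inf[OF comp _ contF] PS by blast
  then obtain Q where QS: "\<And>k. Q k \<in> S" and Qmin: "\<And>k w. w \<in> S \<Longrightarrow> F k (Q k) \<le> F k w"
    by metis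
  define X where "X k = fst (Q k)" for k
  define z where "z k = snd (Q k)" for k
  define E where "E k = (\<Sum>i\<in>I. norm (X k $ i - z k))" for k
  have zC: "z k \<in> C" and zb: "z k \<in> ball p r" and Xb: "X k $ i \<in> ball p r" for k i
    using QS[of k] in_ball[OF QS, of k] by (auto simp: z_def X_def S_def)
  have E0: "E k \<ge> 0" for k unfolding E_def by (intro sum_nonneg) auto
  \<comment> \<open>The added ones make \<open>M\<close> positive even when \<open>L = 0\<close> or
    \<open>I\<close> is empty.\<close>
  define M where "M = (\<bar>L\<bar> + 1) * (real (card I) + 1)"
  have M0: "M > 0" and LIM: "\<bar>L\<bar> * card I \<le> M"
  proof -
    have "M = \<bar>L\<bar> * card I + \<bar>L\<bar> + card I + 1" by (simp add: M_def algebra_simps)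
    moreover have "\<bar>L\<bar> * card I \<ge> 0" by simp
    ultimately show "M > 0" "\<bar>L\<bar> * card I \<le> M" by linarith+
  qed
  \<comment> \<open>\<open>Q k\<close> does at least as well as \<open>P\<close>, and
    \<open>min\<close> replaces the value at \<open>p\<close> by that at \<open>z k\<close>; what is
    left is a difference of values of \<open>g\<close>, at most linear in the gaps.\<close>
  have key: "(norm (z k - p))\<^sup>2 + real (Suc k) * (\<Sum>i\<in>I. (norm (X k $ i - z k))\<^sup>2) \<le> \<bar>L\<bar> * E k" for k
  proof -
    have "(\<Sum>i\<in>I. g (X k $ i) i) + \<psi> (z k) + (norm (z k - p))\<^sup>2
      + real (Suc k) * (\<Sum>i\<in>I. (norm (X k $ i - z k))\<^sup>2) \<le> (\<Sum>i\<in>I. g p i) + \<psi> p"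
      using Qmin[OF PS, of k] by (simp add: F_def P_def X_def z_def)
    also have "\<dots> \<le> (\<Sum>i\<in>I. g (z k) i) + \<psi> (z k)" using min[OF zC zb] .
    finally have 1: "(norm (z k - p))\<^sup>2 + real (Suc k) * (\<Sum>i\<in>I. (norm (X k $ i - z k))\<^sup>2)
       \<le> (\<Sum>i\<in>I. g (z k) i - g (X k $ i) i)" by (simp add: sum_subtractf)
    have "g (z k) i - g (X k $ i) i \<le> \<bar>L\<bar> * norm (X k $ i - z k)" if "i \<in> I" for i
    proof -
      have "g (z k) i - g (X k $ i) i \<le> L * norm (X k $ i - z k)"
        using lipschitz_onD[OF lip[OF that] zb Xb, of k k i]
        by (simp add: dist_norm norm_minus_commute)
      also have "\<dots> \<le> \<bar>L\<bar> * norm (X k $ i - z k)" by (intro mult_right_mono) auto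
      finally show ?thesis .
    qed
    then have "(\<Sum>i\<in>I. g (z k) i - g (X k $ i) i) \<le> \<bar>L\<bar> * E k"
      unfolding E_def sum_distrib_left by (rule sum_mono)
    with 1 show ?thesis by linarith
  qed
  \<comment> \<open>Cauchy-Schwarz bounds \<open>(E k)^2\<close> by a multiple of the sum of squares
    in \<open>key\<close>; cancelling one factor \<open>E k\<close> gives gaps of order
    \<open>1 / k\<close> and hence bounded multipliers.\<close>
  have Ebound: "real (Suc k) * E k \<le> M" for k
  proof (cases "E k = 0")
    case True then show ?thesis using M0 by simp
  next
    case False
    have "real (Suc k) * (E k)\<^sup>2 \<le> real (Suc k) * ((\<Sum>i\<in>I. (norm (X k $ i - z k))\<^sup>2) * card I)"
      unfolding E_def by (intro mult_left_mono sum_squared_le_sum_of_squares) auto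
    also have "\<dots> = (real (Suc k) * (\<Sum>i\<in>I. (norm (X k $ i - z k))\<^sup>2)) * card I" by simp
    also have "\<dots> \<le> (\<bar>L\<bar> * E k) * card I"
      using key[of k] zero_le_power2[of "norm (z k - p)"] by (intro mult_right_mono) linarith+
    also have "\<dots> \<le> M * E k"
      using mult_right_mono[OF LIM E0[of k]] by (simp add: algebra_simps)
    finally have "(real (Suc k) * E k) * E k \<le> M * E k" by (simp add: power2_eq_square algebra_simps)
    then show ?thesis using False E0[of k] by (simp add: mult_le_cancel_right)
  qed
  have E_lim: "E \<longlonglongrightarrow> 0"
  proof (rule tendsto_sandwich[OF _ _ tendsto_const])
    show "(\<lambda>k. M * inverse (real (Suc k))) \<longlonglongrightarrow> 0"
      using tendsto_mult[OF tendsto_const LIMSEQ_inverse_real_of_nat, of M] by simp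
    show "\<forall>\<^sub>F k in sequentially. E k \<le> M * inverse (real (Suc k))"
      using Ebound by (intro always_eventually allI) (simp add: field_simps)
  qed (use E0 in auto)
  have z_lim: "z \<longlonglongrightarrow> p"
  proof -
    have "(\<lambda>k. (norm (z k - p))\<^sup>2) \<longlonglongrightarrow> 0"
    proof (rule tendsto_sandwich[OF _ _ tendsto_const])
      show "(\<lambda>k. \<bar>L\<bar> * E k) \<longlonglongrightarrow> 0" using tendsto_mult[OF tendsto_const E_lim, of "\<bar>L\<bar>"] by simp
      have "(norm (z k - p))\<^sup>2 \<le> \<bar>L\<bar> * E k" for k
      proof -
        have "0 \<le> real (Suc k) * (\<Sum>i\<in>I. (norm (X k $ i - z k))\<^sup>2)"
          by (intro mult_nonneg_nonneg sum_nonneg) auto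
        then show ?thesis using key[of k] by linarith
      qed
      then show "\<forall>\<^sub>F k in sequentially. (norm (z k - p))\<^sup>2 \<le> \<bar>L\<bar> * E k" by simp
    qed auto
    from tendsto_real_sqrt[OF this] have "(\<lambda>k. norm (z k - p)) \<longlonglongrightarrow> 0" by simp
    then show ?thesis by (simp add: tendsto_norm_zero_iff LIM_zero_iff)
  qed
  have dE: "norm (X k $ i - z k) \<le> E k" if "i \<in> I" for i k
    unfolding E_def using that by (intro member_le_sum) auto
  have X_lim: "(\<lambda>k. X k $ i) \<longlonglongrightarrow> p" for i
  proof (cases "i \<in> I")
    case True
    have "(\<lambda>k. X k $ i - z k) \<longlonglongrightarrow> 0"
      by (rule Lim_null_comparison[OF _ E_lim]) (use dE[OF True] in auto)
    from tendsto_add[OF this z_lim] show ?thesis by simp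
  next
    case False
    then have "X k $ i = p" for k using QS[of k] by (auto simp: S_def X_def)
    then show ?thesis by simp
  qed
  have "Q \<longlonglongrightarrow> P"
  proof -
    have "X \<longlonglongrightarrow> (\<chi> i. p)" by (rule vec_tendstoI) (simp add: X_lim)
    from tendsto_Pair[OF this z_lim] show ?thesis by (simp add: P_def X_def z_def)
  qed
  \<comment> \<open>Eventually \<open>Q k\<close> is interior to the ball defining \<open>S\<close>,
    so the ball constraint is inactive and one block can be varied at a time.\<close>
  then have near: "\<forall>\<^sub>F k in sequentially. Q k \<in> ball P (r / 2)"
    using r by (auto simp: tendsto_iff dist_commute elim!: allE[of _ "r / 2"])
  \<comment> \<open>\<open>V k $ i\<close> is minus the penalty gradient in the \<open>i\<close>-th
    block, the candidate subgradient of \<open>g_i\<close>; \<open>W k\<close> is minus the gradient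
    in the block \<open>z\<close>.\<close>
  define V where "V k = (\<chi> i. if i \<in> I then (2 * real (Suc k)) *\<^sub>R (z k - X k $ i) else 0)" for k
  define W where "W k = - (G (z k) + 2 *\<^sub>R (z k - p) + (\<Sum>i\<in>I. V k $ i))" for k
  have sub: "\<forall>\<^sub>F k in sequentially. (V k $ i, -1) \<in>
      regular_normal_cone (X k $ i, g (X k $ i) i) (epigraph UNIV (\<lambda>z. g z i))" if i: "i \<in> I" for i
    using near
  proof eventually_elim
    case (elim k)
    \<comment> \<open>\<open>R u\<close> moves only the \<open>i\<close>-th block of
      \<open>Q k\<close>, so every other term of \<open>F k\<close> cancels and a local minimum in
      \<open>u\<close> remains.\<close>
    define R where "R u = ((\<chi> j. if j = i then u else X k $ j), z k)" for u
    have R_id: "R (X k $ i) = Q k"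
      by (auto simp: R_def X_def z_def prod_eq_iff vec_eq_iff)
    have "((\<lambda>u. if j = i then u else X k $ j) \<longlongrightarrow> X k $ j) (nhds (X k $ i))" for j
      by (cases "j = i") (simp_all add: filterlim_ident)
    then have "(R \<longlongrightarrow> R (X k $ i)) (nhds (X k $ i))"
      unfolding R_def by (intro tendsto_Pair tendsto_const vec_tendstoI) (simp add: filterlim_ident)
    then have "(R \<longlongrightarrow> Q k) (nhds (X k $ i))" by (simp only: R_id)
    then have "\<forall>\<^sub>F u in nhds (X k $ i). R u \<in> ball P (r / 2)"
      by (rule topological_tendstoD) (use elim in auto)
    then have "\<forall>\<^sub>F u in nhds (X k $ i). g (X k $ i) i + real (Suc k) * (norm (X k $ i - z k))\<^sup>2
        \<le> g u i + real (Suc k) * (norm (u - z k))\<^sup>2"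
    proof eventually_elim
      case (elim u)
      have "R u \<in> S" using elim zC i QS[of k] by (auto simp: S_def R_def X_def)
      from Qmin[OF this, of k] have *: "F k (Q k) \<le> F k (R u)" .
      have "(\<Sum>j\<in>I - {i}. g (fst (R u) $ j) j) = (\<Sum>j\<in>I - {i}. g (X k $ j) j)"
        and "(\<Sum>j\<in>I - {i}. (norm (fst (R u) $ j - z k))\<^sup>2) = (\<Sum>j\<in>I - {i}. (norm (X k $ j - z k))\<^sup>2)"
        by (auto intro!: sum.cong simp: R_def)
      moreover have "snd (R u) = z k" "fst (R u) $ i = u" by (auto simp: R_def)
      ultimately show ?case
        using * by (simp add: F_def sum.remove[OF finite i] algebra_simps flip: X_def z_def)
    qed
    moreover have "((\<lambda>u. real (Suc k) * (norm (u - z k))\<^sup>2) has_derivative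
        (\<lambda>h. ((2 * real (Suc k)) *\<^sub>R (X k $ i - z k)) \<bullet> h)) (at (X k $ i))"
      using has_derivative_mult_right[OF has_derivative_power2_norm_diff, of "real (Suc k)" "z k" "X k $ i"]
      by (simp only: inner_scaleR_left mult_ac)
    ultimately have "(- ((2 * real (Suc k)) *\<^sub>R (X k $ i - z k)), -1) \<in>
        regular_normal_cone (X k $ i, g (X k $ i) i) (epigraph UNIV (\<lambda>z. g z i))"
      by (rule regular_normal_cone_epigraph)
    moreover have "- ((2 * real (Suc k)) *\<^sub>R (X k $ i - z k)) = V k $ i"
      using i by (simp add: V_def algebra_simps)
    ultimately show ?case by simp
  qed
  \<comment> \<open>With the blocks \<open>X k\<close> fixed, \<open>z k\<close> minimizes the
    differentiable part of \<open>F k\<close> over \<open>C\<close> near itself.\<close>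
  have nor: "\<forall>\<^sub>F k in sequentially. W k \<in> regular_normal_cone (z k) C"
    using near
  proof eventually_elim
    case (elim k)
    let ?h = "\<lambda>u. \<psi> u + (norm (u - p))\<^sup>2 + (\<Sum>i\<in>I. real (Suc k) * (norm (u - X k $ i))\<^sup>2)"
    have "((\<lambda>u. (X k, u)) \<longlongrightarrow> Q k) (at (z k) within C)"
      by (auto simp: X_def z_def intro!: tendsto_eq_intros)
    then have "\<forall>\<^sub>F u in at (z k) within C. (X k, u) \<in> ball P (r / 2)"
      by (rule topological_tendstoD) (use elim in auto)
    moreover have "\<forall>\<^sub>F u in at (z k) within C. u \<in> C"
      by (simp add: eventually_at_filter)
    ultimately have "\<forall>\<^sub>F u in at (z k) within C. ?h (z k) \<le> ?h u"
    proof eventually_elim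
      case (elim u)
      have "(X k, u) \<in> S" using elim QS[of k] by (auto simp: S_def X_def)
      from Qmin[OF this, of k] show ?case
        by (simp add: F_def sum_distrib_left norm_minus_commute flip: X_def z_def)
    qed
    moreover have "(?h has_derivative (\<lambda>h. (G (z k) + 2 *\<^sub>R (z k - p) + (\<Sum>i\<in>I. V k $ i)) \<bullet> h)) (at (z k))"
    proof -
      have "(?h has_derivative (\<lambda>h. G (z k) \<bullet> h + (2 *\<^sub>R (z k - p)) \<bullet> h
          + (\<Sum>i\<in>I. real (Suc k) * ((2 *\<^sub>R (z k - X k $ i)) \<bullet> h)))) (at (z k))"
        by (intro has_derivative_add der has_derivative_power2_norm_diff has_derivative_sum
            has_derivative_mult_right)
      moreover have "(\<Sum>i\<in>I. real (Suc k) * ((2 *\<^sub>R (z k - X k $ i)) \<bullet> h)) = (\<Sum>i\<in>I. V k $ i) \<bullet> h" for h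
        unfolding inner_sum_left by (intro sum.cong) (auto simp: V_def)
      ultimately show ?thesis by (simp only: inner_add_left)
    qed
    ultimately show ?case
      unfolding W_def by (intro regular_normal_cone_minimizer) (auto intro: has_derivative_at_withinI)
  qed
  \<comment> \<open>Bounded multipliers allow passing to a convergent subsequence of
    \<open>V\<close>; along it \<open>W\<close> converges too, by continuity of \<open>G\<close> at
    \<open>p\<close>.\<close>
  have "bounded (range V)"
  proof -
    have "norm (V k) \<le> (\<Sum>i\<in>(UNIV::'i set). 2 * M)" for k
    proof -
      have "norm (V k $ i) \<le> 2 * M" for i
      proof (cases "i \<in> I")
        case True
        have "norm (V k $ i) = 2 * (real (Suc k) * norm (X k $ i - z k))"
          using True by (simp add: V_def norm_minus_commute)
        also have "\<dots> \<le> 2 * (real (Suc k) * E k)"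
          using dE[OF True] by (intro mult_left_mono) auto
        also have "\<dots> \<le> 2 * M" using Ebound[of k] by linarith
        finally show ?thesis .
      next
        case False then show ?thesis using M0 by (simp add: V_def)
      qed
      then show ?thesis
        unfolding norm_vec_def by (intro order_trans[OF L2_set_le_sum] sum_mono) auto
    qed
    then show ?thesis by (auto simp: bounded_iff)
  qed
  then obtain V' s where s: "strict_mono s" and V_lim: "(V \<circ> s) \<longlonglongrightarrow> V'"
    using bounded_imp_convergent_subsequence by blast
  have ev_s: "\<forall>\<^sub>F k in sequentially. A (s k)" if "\<forall>\<^sub>F k in sequentially. A k" for A
    using that filterlim_subseq[OF s] by (simp add: filterlim_iff)
  have lim_s: "(\<lambda>k. a (s k)) \<longlonglongrightarrow> l" if "a \<longlonglongrightarrow> l" for a and l :: 'a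
    using LIMSEQ_subseq_LIMSEQ[OF that s] by (simp add: o_def)
  have Vi_lim: "(\<lambda>k. V (s k) $ i) \<longlonglongrightarrow> V' $ i" for i
    using tendsto_vec_nth[OF V_lim] by (simp add: o_def)
  show thesis
  proof
    fix i assume i: "i \<in> I"
    have "isCont (\<lambda>z. g z i) p"
      using contg[OF i] r by (simp add: continuous_on_eq_continuous_at)
    then have "(\<lambda>k. (X (s k) $ i, g (X (s k) $ i) i)) \<longlonglongrightarrow> (p, g p i)"
      using lim_s[OF X_lim] by (intro tendsto_Pair) (auto intro: isCont_tendsto_compose)
    moreover have "(\<lambda>k. (V (s k) $ i, -1 :: real)) \<longlonglongrightarrow> (V' $ i, -1)"
      by (intro tendsto_Pair Vi_lim tendsto_const)
    ultimately show "V' $ i \<in> subdiff (\<lambda>z. g z i) p"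
      unfolding subdiff_def mem_Collect_eq
      by (intro normal_coneI[OF eventually_mono[OF ev_s[OF sub[OF i]]]]) (auto simp: epigraph_def)
  next
    have "(\<lambda>k. W (s k)) \<longlonglongrightarrow> - (G p + 2 *\<^sub>R (p - p) + (\<Sum>i\<in>I. V' $ i))"
      unfolding W_def
      by (intro tendsto_intros Vi_lim lim_s[OF z_lim] isCont_tendsto_compose[OF contG])
    then show "- (G p + 2 *\<^sub>R (p - p) + (\<Sum>i\<in>I. V' $ i)) \<in> normal_cone p C"
      by (intro normal_coneI[OF eventually_mono[OF ev_s[OF nor]] lim_s[OF z_lim]]) (auto simp: zC)
  qed simp
qed

subsection \<open>Penalized minimizers\<close>

text \<open>A combination with unit coefficients becomes admissible after division by
  \<open>card I\<close>, since the normal cone is closed under positive scaling; the factor is at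
  most 1, so the norm does not grow.\<close>

lemma rabier_bounds:
  assumes "finite I" "I \<noteq> {}"
    and v: "\<And>i. i \<in> I \<Longrightarrow> v i \<in> subdiff (\<lambda>z. g z i) x" and \<omega>: "\<omega> \<in> normal_cone x C"
  shows "0 \<le> rabier I g C x" and "rabier I g C x \<le> norm ((\<Sum>i\<in>I. v i) + \<omega>)"
proof -
  let ?N = "{norm ((\<Sum>i\<in>I. \<alpha> i *\<^sub>R v i) + \<omega>) | \<alpha> v \<omega>.
            (\<forall>i\<in>I. v i \<in> subdiff (\<lambda>z. g z i) x) \<and> \<omega> \<in> normal_cone x C \<and>
            (\<forall>i\<in>I. 0 \<le> \<alpha> i) \<and> (\<Sum>i\<in>I. \<alpha> i) = 1}"
  define c where "c = 1 / real (card I)"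
  have card: "card I > 0" using assms by (simp add: card_gt_0_iff)
  then have c: "c > 0" "c \<le> 1" "real (card I) * c = 1" by (auto simp: c_def)
  \<comment> \<open>This also shows that the set is nonempty, on which the lower bound for the real
    \<open>Inf\<close> relies.\<close>
  have mem: "norm ((\<Sum>i\<in>I. c *\<^sub>R v i) + c *\<^sub>R \<omega>) \<in> ?N"
    using v c normal_cone_scale[OF \<omega> c(1)]
    by (intro CollectI exI[of _ "\<lambda>_. c"] exI[of _ v] exI[of _ "c *\<^sub>R \<omega>"]) auto
  then show "0 \<le> rabier I g C x"
    unfolding rabier_def by (intro cInf_greatest) auto
  have "rabier I g C x \<le> norm ((\<Sum>i\<in>I. c *\<^sub>R v i) + c *\<^sub>R \<omega>)"
    unfolding rabier_def using mem by (rule cInf_lower) (auto intro!: bdd_belowI[of _ 0])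
  also have "\<dots> = c * norm ((\<Sum>i\<in>I. v i) + \<omega>)"
    using c(1) by (simp flip: scaleR_sum_right scaleR_add_right)
  also have "\<dots> \<le> norm ((\<Sum>i\<in>I. v i) + \<omega>)"
    using c by (intro mult_left_le_one_le) auto
  finally show "rabier I g C x \<le> norm ((\<Sum>i\<in>I. v i) + \<omega>)" .
qed

text \<open>Dividing by \<open>card I + \<bar>c\<bar>\<close>, positive because \<open>I\<close> is
  nonempty, normalizes the multipliers, and the normal cone absorbs the scaling.\<close>

lemma tangency_varietyI:
  assumes "finite I" "I \<noteq> {}" and x: "x \<in> C"
    and v: "\<And>i. i \<in> I \<Longrightarrow> v i \<in> subdiff (\<lambda>z. g z i) x" and \<omega>: "\<omega> \<in> normal_cone x C"
    and eq: "(\<Sum>i\<in>I. v i) + c *\<^sub>R x + \<omega> = 0"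
  shows "x \<in> tangency_variety I g C"
proof -
  define t where "t = 1 / (real (card I) + \<bar>c\<bar>)"
  have "card I > 0" using assms by (simp add: card_gt_0_iff)
  then have pos: "real (card I) + \<bar>c\<bar> > 0" by linarith
  then have t: "t > 0" by (simp add: t_def)
  have "real (card I) * t + \<bar>t * c\<bar> = t * (real (card I) + \<bar>c\<bar>)"
    using t by (simp add: abs_mult distrib_left)
  also have "\<dots> = 1" using pos by (simp add: t_def)
  finally have sum1: "real (card I) * t + \<bar>t * c\<bar> = 1" .
  have "(\<Sum>i\<in>I. t *\<^sub>R v i) + (t * c) *\<^sub>R x + t *\<^sub>R \<omega> = t *\<^sub>R ((\<Sum>i\<in>I. v i) + c *\<^sub>R x + \<omega>)"
    by (simp add: scaleR_sum_right scaleR_add_right)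
  then have "(\<Sum>i\<in>I. t *\<^sub>R v i) + (t * c) *\<^sub>R x + t *\<^sub>R \<omega> = 0"
    by (simp add: eq)
  then show ?thesis
    unfolding tangency_variety_def mem_Collect_eq
    using x v t sum1 normal_cone_scale[OF \<omega> t]
    by (intro conjI exI[of _ v] exI[of _ "\<lambda>_. t"] exI[of _ "t * c"] bexI[of _ "t *\<^sub>R \<omega>"]) auto
qed

section \<open>The Fermat rule for the components of a locally Lipschitz mapping\<close>

lemma locally_lipschitz_continuous_on:
  assumes "locally_lipschitz f"
  shows "continuous_on S f"
proof (rule continuous_at_imp_continuous_on, rule ballI)
  fix x
  obtain r L where "r > 0" "L-lipschitz_on (ball x r) f"
    using assms unfolding locally_lipschitz_def by blast
  then show "isCont f x"
    using lipschitz_on_continuous_on[of L "ball x r" f] by (simp add: continuous_on_eq_continuous_at)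
qed

text \<open>Each component of \<open>f\<close> inherits its local Lipschitz constant. The
  existential form lets multipliers be chosen along a whole sequence of minimizers.\<close>

lemma Fermat_rule_subvector:
  fixes f :: "'a::euclidean_space \<Rightarrow> real ^ 's" and C :: "'a set"
  assumes f: "locally_lipschitz f" and C: "closed C" "p \<in> C"
    and der: "\<And>z. (\<psi> has_derivative (\<lambda>h. G z \<bullet> h)) (at z)" and contG: "isCont G p"
    and min: "\<And>u. u \<in> C \<Longrightarrow> (\<Sum>i\<in>I. f p $ i) + \<psi> p \<le> (\<Sum>i\<in>I. f u $ i) + \<psi> u"
  shows "\<exists>v \<omega>. (\<forall>i\<in>I. v i \<in> subdiff (\<lambda>z. subvector f I z i) p) \<and>
    \<omega> \<in> normal_cone p C \<and> (\<Sum>i\<in>I. v i) + G p + \<omega> = 0"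
proof -
  obtain r L where r: "r > 0" and L: "L-lipschitz_on (ball p r) f"
    using f unfolding locally_lipschitz_def by blast
  have "L-lipschitz_on (ball p r) (\<lambda>z. subvector f I z i)" if "i \<in> I" for i
  proof (rule lipschitz_onI)
    fix x y assume "x \<in> ball p r" "y \<in> ball p r"
    then have "dist (f x) (f y) \<le> L * dist x y" by (rule lipschitz_onD[OF L])
    then show "dist (subvector f I x i) (subvector f I y i) \<le> L * dist x y"
      using dist_vec_nth_le[of "f x" i "f y"] that by (simp add: subvector_def)
  qed (rule lipschitz_on_nonneg[OF L])
  moreover have "(\<Sum>i\<in>I. subvector f I p i) + \<psi> p \<le> (\<Sum>i\<in>I. subvector f I u i) + \<psi> u"
    if "u \<in> C" for u
    using min[OF that] by (simp add: subvector_def)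
  ultimately show ?thesis
    by (rule Fermat_rule_sum[OF C r _ der contG]) auto
qed

section \<open>The logarithmic penalty\<close>

lemma has_derivative_log_penalty:
  fixes z :: "'a::euclidean_space"
  shows "((\<lambda>x. \<delta> * ln (1 + (norm x)\<^sup>2)) has_derivative
           (\<lambda>h. ((2 * \<delta> / (1 + (norm z)\<^sup>2)) *\<^sub>R z) \<bullet> h)) (at z)"
proof -
  have "1 + z \<bullet> z > 0" by (simp add: add_pos_nonneg)
  then show ?thesis
    unfolding power2_norm_eq_inner
    by (auto intro!: derivative_eq_intros simp: inner_commute field_simps)
qed

text \<open>The penalty tends to infinity while \<open>\<phi>\<close> stays above \<open>b\<close>,
  so the sum is coercive and only a compact part of \<open>C\<close> matters.\<close>

lemma log_penalty_minimizer_exists: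
  fixes \<phi> :: "'a::euclidean_space \<Rightarrow> real"
  assumes C: "closed C" "C \<noteq> {}" and cont: "continuous_on C \<phi>"
    and bound: "\<And>x. x \<in> C \<Longrightarrow> b \<le> \<phi> x" and "\<delta> > 0"
  shows "\<exists>x\<in>C. \<forall>u\<in>C. \<phi> x + \<delta> * ln (1 + (norm x)\<^sup>2) \<le> \<phi> u + \<delta> * ln (1 + (norm u)\<^sup>2)"
proof -
  let ?F = "\<lambda>x. \<phi> x + \<delta> * ln (1 + (norm x)\<^sup>2)"
  obtain x0 where x0: "x0 \<in> C" using C by blast
  \<comment> \<open>\<open>R\<close> solves \<open>\<delta> * ln (R^2) = ?F x0 - b\<close>; beyond
    it, \<open>b\<close> plus the penalty already exceeds \<open>?F x0\<close>.\<close>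
  define R where "R = sqrt (exp ((?F x0 - b) / \<delta>))"
  have pos: "1 + (norm x)\<^sup>2 > 0" for x :: 'a by (simp add: add_pos_nonneg)
  have large: "?F x > ?F x0" if "x \<in> C" "x \<notin> cball 0 R" for x
  proof -
    have "R\<^sup>2 < (norm x)\<^sup>2" using that by (intro power_strict_mono) (auto simp: R_def)
    then have "exp ((?F x0 - b) / \<delta>) < 1 + (norm x)\<^sup>2" by (simp add: R_def)
    then have "(?F x0 - b) / \<delta> < ln (1 + (norm x)\<^sup>2)"
      using pos[of x] by (metis exp_gt_zero ln_exp ln_less_cancel_iff)
    then have "?F x0 - b < \<delta> * ln (1 + (norm x)\<^sup>2)"
      using \<open>\<delta> > 0\<close> by (simp add: divide_less_eq mult.commute)
    with bound[OF that(1)] show ?thesis by linarith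
  qed
  have "x0 \<in> cball 0 R" using large[OF x0] by blast
  moreover have "compact (C \<inter> cball 0 R)" using C by (simp add: closed_Int_compact)
  moreover have "continuous_on (C \<inter> cball 0 R) ?F"
    using pos by (intro continuous_intros continuous_on_subset[OF cont]) (auto simp: less_imp_neq[symmetric])
  ultimately obtain x where x: "x \<in> C \<inter> cball 0 R" "\<And>u. u \<in> C \<inter> cball 0 R \<Longrightarrow> ?F x \<le> ?F u"
    using continuous_attains_inf[of "C \<inter> cball 0 R" ?F] x0 by blast
  have "?F x \<le> ?F u" if "u \<in> C" for u
  proof (cases "u \<in> cball 0 R")
    case False
    then show ?thesis
      using large[OF that] x(2)[of x0] x0 \<open>x0 \<in> cball 0 R\<close> by force
  qed (use x that in auto)
  with x show ?thesis by blast
qed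

text \<open>
  The gradient of the penalty \<open>\<delta> ln (1 + \<parallel>x\<parallel>\<^sup>2)\<close> is a multiple of \<open>x\<close> and satisfies
  \<open>\<parallel>x\<parallel> \<parallel>\<nabla>\<parallel> \<le> 2\<delta>\<close>; hence one sequence of penalized minimizers serves the three asymptotic sets.
\<close>

lemma penalized_sequence:
  fixes f :: "'a::euclidean_space \<Rightarrow> real ^ 's" and C :: "'a set"
  assumes f: "locally_lipschitz f" and C: "closed C" "C \<noteq> {}" and I: "I \<noteq> {}"
    and lower: "\<And>x i. x \<in> C \<Longrightarrow> i \<in> I \<Longrightarrow> a i \<le> f x $ i"
  shows "\<exists>x. (\<forall>k. x k \<in> C \<and> x k \<in> tangency_variety I (subvector f I) C \<and>
        0 \<le> rabier I (subvector f I) C (x k)) \<and>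
      (\<lambda>k. norm (x k) * rabier I (subvector f I) C (x k)) \<longlonglongrightarrow> 0 \<and>
      (\<forall>s l u. strict_mono s \<longrightarrow> (\<lambda>k. \<Sum>i\<in>I. f (x (s k)) $ i) \<longlonglongrightarrow> l \<longrightarrow> u \<in> C \<longrightarrow>
        l \<le> (\<Sum>i\<in>I. f u $ i))"
proof -
  define \<phi> where "\<phi> u = (\<Sum>i\<in>I. f u $ i)" for u
  define \<psi> where "\<psi> k u = inverse (real (Suc k)) * ln (1 + (norm u)\<^sup>2)" for k and u :: 'a
  have \<psi>0: "0 \<le> \<psi> k u" for k u unfolding \<psi>_def by (intro mult_nonneg_nonneg ln_ge_zero) auto
  have "continuous_on C \<phi>"
    unfolding \<phi>_def using f by (intro continuous_intros locally_lipschitz_continuous_on)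
  moreover have "(\<Sum>i\<in>I. a i) \<le> \<phi> u" if "u \<in> C" for u
    unfolding \<phi>_def using lower[OF that] by (rule sum_mono)
  ultimately have "\<exists>x\<in>C. \<forall>u\<in>C. \<phi> x + \<psi> k x \<le> \<phi> u + \<psi> k u" for k
    unfolding \<psi>_def by (intro log_penalty_minimizer_exists C) auto
  then obtain x where xC: "\<And>k. x k \<in> C" and xmin: "\<And>k u. u \<in> C \<Longrightarrow> \<phi> (x k) + \<psi> k (x k) \<le> \<phi> u + \<psi> k u"
    by metis
  define c where "c k z = 2 * inverse (real (Suc k)) / (1 + (norm z)\<^sup>2)" for k and z :: 'a
  have pos: "1 + (norm z)\<^sup>2 > 0" for z :: 'a by (simp add: add_pos_nonneg)
  have c0: "c k z \<ge> 0" for k z using pos[of z] by (simp add: c_def)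
  have cont_grad: "isCont (\<lambda>z. c k z *\<^sub>R z) (x k)" for k
    unfolding c_def using pos by (intro continuous_intros) (auto simp: less_imp_neq[symmetric])
  have der: "(\<psi> k has_derivative (\<lambda>h. (c k z *\<^sub>R z) \<bullet> h)) (at z)" for k z
    unfolding \<psi>_def c_def by (rule has_derivative_log_penalty)
  have "\<exists>v \<omega>. (\<forall>i\<in>I. v i \<in> subdiff (\<lambda>z. subvector f I z i) (x k)) \<and>
      \<omega> \<in> normal_cone (x k) C \<and> (\<Sum>i\<in>I. v i) + c k (x k) *\<^sub>R x k + \<omega> = 0" for k
    by (rule Fermat_rule_subvector[OF f C(1) xC der cont_grad xmin[unfolded \<phi>_def]])
  then obtain v \<omega> where v: "\<And>k i. i \<in> I \<Longrightarrow> v k i \<in> subdiff (\<lambda>z. subvector f I z i) (x k)"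
    and \<omega>: "\<And>k. \<omega> k \<in> normal_cone (x k) C"
    and eq: "\<And>k. (\<Sum>i\<in>I. v k i) + c k (x k) *\<^sub>R x k + \<omega> k = 0"
    by metis
  have rab0: "0 \<le> rabier I (subvector f I) C (x k)" for k
    using v \<omega> I by (intro rabier_bounds(1)[of I "v k" _ _ "\<omega> k"]) auto
  have rab: "norm (x k) * rabier I (subvector f I) C (x k) \<le> 2 * inverse (real (Suc k))" for k
  proof -
    have "rabier I (subvector f I) C (x k) \<le> norm ((\<Sum>i\<in>I. v k i) + \<omega> k)"
      using v \<omega> I by (intro rabier_bounds(2)) auto
    also have "(\<Sum>i\<in>I. v k i) + \<omega> k = - (c k (x k) *\<^sub>R x k)"
      using eq[of k] by (simp add: algebra_simps eq_neg_iff_add_eq_0)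
    also have "norm \<dots> = c k (x k) * norm (x k)" using c0 by simp
    finally have "norm (x k) * rabier I (subvector f I) C (x k) \<le> norm (x k) * (c k (x k) * norm (x k))"
      by (intro mult_left_mono) auto
    also have "\<dots> = 2 * inverse (real (Suc k)) * ((norm (x k))\<^sup>2 / (1 + (norm (x k))\<^sup>2))"
      by (simp add: c_def power2_eq_square)
    also have "\<dots> \<le> 2 * inverse (real (Suc k)) * 1"
      using pos[of "x k"] by (intro mult_left_mono) (auto simp: divide_le_eq)
    finally show ?thesis by simp
  qed
  have inv_lim: "(\<lambda>k. t * inverse (real (Suc k))) \<longlonglongrightarrow> 0" for t
    using tendsto_mult[OF tendsto_const LIMSEQ_inverse_real_of_nat, of t] by simp
  show ?thesis
  proof (intro exI[of _ x] conjI allI impI)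
    show "x k \<in> C" for k by (rule xC)
    show "x k \<in> tangency_variety I (subvector f I) C" for k
      using v \<omega> I eq xC by (intro tangency_varietyI[of I _ _ "v k" _ "\<omega> k" "c k (x k)"]) auto
    show "0 \<le> rabier I (subvector f I) C (x k)" for k by (rule rab0)
    show "(\<lambda>k. norm (x k) * rabier I (subvector f I) C (x k)) \<longlonglongrightarrow> 0"
      by (rule tendsto_sandwich[OF _ _ tendsto_const inv_lim[of 2]]) (use rab rab0 in auto)
  next
    fix s l u
    assume s: "strict_mono s" and l: "(\<lambda>k. \<Sum>i\<in>I. f (x (s k)) $ i) \<longlonglongrightarrow> l" and u: "u \<in> C"
    have "(\<lambda>k. \<phi> u + \<psi> (s k) u) \<longlonglongrightarrow> \<phi> u + 0"
      using LIMSEQ_subseq_LIMSEQ[OF inv_lim[of "ln (1 + (norm u)\<^sup>2)"] s]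
      by (intro tendsto_intros) (simp add: \<psi>_def o_def mult.commute)
    moreover have "\<phi> (x (s k)) \<le> \<phi> u + \<psi> (s k) u" for k
      using xmin[OF u, of "s k"] \<psi>0[of "s k" "x (s k)"] by linarith
    ultimately have "l \<le> \<phi> u + 0"
      using l by (intro LIMSEQ_le[of "\<lambda>k. \<phi> (x (s k))"]) (auto simp: \<phi>_def)
    then show "l \<le> (\<Sum>i\<in>I. f u $ i)" by (simp add: \<phi>_def)
  qed
qed

subsection \<open>Weak Pareto solutions\<close>

text \<open>A point strictly better in every component stays in the section and has a strictly
  smaller sum over the nonempty \<open>I\<close>, against minimality.\<close>

lemma weak_Pareto_sum_minimizer:
  fixes f :: "'a \<Rightarrow> real ^ 's"
  assumes "x \<in> section_at K f x0" and "I \<noteq> {}"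
    and min: "\<And>u. u \<in> section_at K f x0 \<Longrightarrow> (\<Sum>i\<in>I. f x $ i) \<le> (\<Sum>i\<in>I. f u $ i)"
  shows "weak_Pareto K f x"
proof -
  have False if "z \<in> K" and less: "\<And>i. f z $ i < f x $ i" for z
  proof -
    have "z \<in> section_at K f x0"
      using assms(1) that by (auto simp: section_at_def intro: less_imp_le less_le_trans)
    moreover have "(\<Sum>i\<in>I. f z $ i) < (\<Sum>i\<in>I. f x $ i)"
      using \<open>I \<noteq> {}\<close> less by (intro sum_strict_mono) auto
    ultimately show False using min by force
  qed
  then show ?thesis using assms(1) by (auto simp: weak_Pareto_def section_at_def)
qed

lemma closed_section_at:
  fixes f :: "'a::metric_space \<Rightarrow> real ^ 's"
  assumes "locally_lipschitz f" and "closed K"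
  shows "closed (section_at K f x0)"
proof -
  have "closed {x. \<forall>i. f x $ i \<le> f x0 $ i}"
    using locally_lipschitz_continuous_on[OF assms(1), of UNIV]
    by (intro closed_Collect_all closed_Collect_le continuous_intros)
  with assms(2) show ?thesis
    unfolding section_at_def by (simp add: Collect_conj_eq closed_Int)
qed

section \<open>From an asymptotic inclusion to a weak Pareto solution\<close>

text \<open>The inclusion for the intersection is implied by the inclusion for any one of the three
  sets; it suffices because unbounded penalized minimizers produce a value lying in all three at
  once.\<close>

lemma weak_Pareto_if_asymptotic_inclusion:
  fixes f :: "'a::euclidean_space \<Rightarrow> real ^ 's" and K :: "'a set"
  defines "g \<equiv> subvector f" and "C \<equiv> section_at K f"
  assumes f: "locally_lipschitz f" and K: "closed K" "x0 \<in> K" and I: "I \<noteq> {}"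
    and bounded: "weakly_section_bounded K f I x0"
    and incl: "K_tilde_inf I (g I) (C x0) (g I x0) \<inter> K_inf I (g I) (C x0) (g I x0) \<inter>
      T_inf I (g I) (C x0) (g I x0) \<subseteq> K_zero I (g I) (C x0) (g I x0)"
  shows "\<exists>x. weak_Pareto K f x"
proof -
  have closed: "closed (C x0)" unfolding C_def by (rule closed_section_at[OF f K(1)])
  have "x0 \<in> C x0" using K by (simp add: C_def section_at_def)
  then have ne: "C x0 \<noteq> {}" by blast
  obtain a where "g I ` C x0 \<subseteq> {y \<in> I \<rightarrow>\<^sub>E UNIV. \<forall>i\<in>I. a i \<le> y i}"
    using bounded unfolding weakly_section_bounded_def C_def g_def by blast
  then have "a i \<le> g I x i" if "x \<in> C x0" "i \<in> I" for x i
    using that by blast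
  then have lower: "a i \<le> f x $ i" if "x \<in> C x0" "i \<in> I" for x i
    using that by (simp add: g_def subvector_def)
  have upper: "f x $ i \<le> f x0 $ i" if "x \<in> C x0" for x i
    using that by (simp add: C_def section_at_def)
  have "\<exists>x. (\<forall>k. x k \<in> C x0 \<and> x k \<in> tangency_variety I (g I) (C x0) \<and>
        0 \<le> rabier I (g I) (C x0) (x k)) \<and>
      (\<lambda>k. norm (x k) * rabier I (g I) (C x0) (x k)) \<longlonglongrightarrow> 0 \<and>
      (\<forall>s l u. strict_mono s \<longrightarrow> (\<lambda>k. \<Sum>i\<in>I. f (x (s k)) $ i) \<longlonglongrightarrow> l \<longrightarrow> u \<in> C x0 \<longrightarrow>
        l \<le> (\<Sum>i\<in>I. f u $ i))"
    unfolding g_def by (rule penalized_sequence[OF f closed ne I lower])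
  then obtain x where xC: "\<And>k. x k \<in> C x0" and xT: "\<And>k. x k \<in> tangency_variety I (g I) (C x0)"
    and rab0: "\<And>k. 0 \<le> rabier I (g I) (C x0) (x k)"
    and rab: "(\<lambda>k. norm (x k) * rabier I (g I) (C x0) (x k)) \<longlonglongrightarrow> 0"
    and lim: "\<And>s l u. strict_mono s \<Longrightarrow> (\<lambda>k. \<Sum>i\<in>I. f (x (s k)) $ i) \<longlonglongrightarrow> l \<Longrightarrow> u \<in> C x0 \<Longrightarrow>
           l \<le> (\<Sum>i\<in>I. f u $ i)"
    by blast
  have "\<exists>p\<in>C x0. \<forall>u\<in>C x0. (\<Sum>i\<in>I. f p $ i) \<le> (\<Sum>i\<in>I. f u $ i)"
  proof (cases "filterlim (\<lambda>k. norm (x k)) at_top sequentially")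
    case False
    \<comment> \<open>Infinitely many terms stay in the ball of radius \<open>B\<close>; a cluster
      point of them minimizes the sum by \<open>lim\<close> and continuity.\<close>
    then obtain B where B: "\<not> (\<forall>\<^sub>F k in sequentially. B \<le> norm (x k))"
      by (auto simp: filterlim_at_top)
    then obtain s :: "nat \<Rightarrow> nat" where s: "strict_mono s" and small: "\<And>k. \<not> B \<le> norm (x (s k))"
      using not_eventually_sequentiallyD[OF B] by blast
    from small have "bounded (range (x \<circ> s))"
      unfolding bounded_iff by (intro exI[of _ B]) (simp add: less_imp_le not_le)
    then obtain p t where t: "strict_mono t" and p: "((x \<circ> s) \<circ> t) \<longlonglongrightarrow> p"
      using bounded_imp_convergent_subsequence by blast
    have pC: "p \<in> C x0"
      using closed_sequentially[OF closed _ p] xC by simp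
    have "isCont f p"
      using locally_lipschitz_continuous_on[OF f, of UNIV] by (simp add: continuous_on_eq_continuous_at)
    from isCont_tendsto_compose[OF this p]
    have "(\<lambda>k. \<Sum>i\<in>I. f (x ((s \<circ> t) k)) $ i) \<longlonglongrightarrow> (\<Sum>i\<in>I. f p $ i)"
      by (intro tendsto_intros) (simp add: o_def)
    from lim[OF strict_mono_o[OF s t] this] pC show ?thesis by blast
  next
    case True
    \<comment> \<open>Components outside \<open>I\<close> are set to 0: only those in
      \<open>I\<close> have the lower bound \<open>a\<close>, so only their values are made to
      converge.\<close>
    define w where "w k = (\<chi> i. if i \<in> I then f (x k) $ i else 0)" for k
    have "bounded (range w)"
    proof -
      have "norm (w k) \<le> (\<Sum>i\<in>UNIV. \<bar>a i\<bar> + \<bar>f x0 $ i\<bar>)" for k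
      proof -
        have "norm (w k $ i) \<le> \<bar>a i\<bar> + \<bar>f x0 $ i\<bar>" for i
        proof (cases "i \<in> I")
          case True
          then show ?thesis
            using lower[OF xC True, of k] upper[OF xC, of k i] by (simp add: w_def)
        qed (simp add: w_def)
        then show ?thesis
          unfolding norm_vec_def by (intro order_trans[OF L2_set_le_sum] sum_mono) auto
      qed
      then show ?thesis by (auto simp: bounded_iff)
    qed
    then obtain y s where s: "strict_mono s" and y: "(w \<circ> s) \<longlonglongrightarrow> y"
      using bounded_imp_convergent_subsequence by blast
    have fy: "(\<lambda>k. f (x (s k)) $ i) \<longlonglongrightarrow> y $ i" if "i \<in> I" for i
      using tendsto_vec_nth[OF y, of i] that by (simp add: o_def w_def)
    define Y where "Y = (\<lambda>i\<in>I. y $ i)"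
    have norm_s: "filterlim (\<lambda>k. norm (x (s k))) at_top sequentially"
      using filterlim_compose[OF True filterlim_subseq[OF s]] .
    have rab_s: "(\<lambda>k. norm (x (s k)) * rabier I (g I) (C x0) (x (s k))) \<longlonglongrightarrow> 0"
      using LIMSEQ_subseq_LIMSEQ[OF rab s] by (simp add: o_def)
    \<comment> \<open>The factor \<open>norm (x (s k))\<close> is eventually at least 1, so the
      weighted sequence dominates the unweighted one.\<close>
    have rab_s': "(\<lambda>k. rabier I (g I) (C x0) (x (s k))) \<longlonglongrightarrow> 0"
    proof (rule tendsto_sandwich[OF _ _ tendsto_const rab_s])
      have "\<forall>\<^sub>F k in sequentially. 1 \<le> norm (x (s k))"
        using norm_s by (simp add: filterlim_at_top)
      then show "\<forall>\<^sub>F k in sequentially. rabier I (g I) (C x0) (x (s k))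
          \<le> norm (x (s k)) * rabier I (g I) (C x0) (x (s k))"
      proof eventually_elim
        case (elim k)
        from mult_right_mono[OF this rab0[of "s k"]] show ?case by simp
      qed
    qed (simp add: rab0)
    have "Y \<in> I \<rightarrow>\<^sub>E UNIV" by (simp add: Y_def)
    moreover have "\<forall>k. x (s k) \<in> C x0 \<and> (\<forall>i\<in>I. g I (x (s k)) i \<le> g I x0 i)"
      using xC upper by (simp add: g_def subvector_def)
    moreover have "\<forall>i\<in>I. (\<lambda>k. g I (x (s k)) i) \<longlonglongrightarrow> Y i"
      using fy by (simp add: g_def subvector_def Y_def)
    ultimately have "Y \<in> K_tilde_inf I (g I) (C x0) (g I x0) \<inter> K_inf I (g I) (C x0) (g I x0) \<inter>
        T_inf I (g I) (C x0) (g I x0)"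
      unfolding K_tilde_inf_def K_inf_def T_inf_def
      using norm_s rab_s rab_s' xT by (intro IntI CollectI conjI exI[of _ "\<lambda>k. x (s k)"]) auto
    with incl have "Y \<in> K_zero I (g I) (C x0) (g I x0)" by (rule subsetD)
    then obtain p where p: "p \<in> C x0" "Y = g I p"
      unfolding K_zero_def by blast
    \<comment> \<open>\<open>p\<close> need not be a limit of the sequence: it only realizes the
      limit value \<open>y\<close> on \<open>I\<close>, and by \<open>lim\<close> the sum of that
      value is a lower bound on the section.\<close>
    have "f p $ i = y $ i" if "i \<in> I" for i
      using fun_cong[OF p(2), of i] that by (simp add: Y_def g_def subvector_def)
    then have sum_eq: "(\<Sum>i\<in>I. f p $ i) = (\<Sum>i\<in>I. y $ i)"
      by (rule sum.cong[OF refl])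
    have lim_y: "(\<lambda>k. \<Sum>i\<in>I. f (x (s k)) $ i) \<longlonglongrightarrow> (\<Sum>i\<in>I. y $ i)"
      using fy by (intro tendsto_sum)
    show ?thesis
      using lim[OF s lim_y] p(1) by (intro bexI[of _ p]) (auto simp: sum_eq)
  qed
  then obtain p where "p \<in> C x0" and "\<And>u. u \<in> C x0 \<Longrightarrow> (\<Sum>i\<in>I. f p $ i) \<le> (\<Sum>i\<in>I. f u $ i)"
    by blast
  then have "weak_Pareto K f p"
    unfolding C_def by (intro weak_Pareto_sum_minimizer[OF _ I])
  then show ?thesis ..
qed

section \<open>From a weak Pareto solution to the asymptotic inclusions\<close>

text \<open>
  Among the points of \<open>K\<^bsub>x*\<^esub>\<close> choose \<open>x\<^sub>0\<close> with the fewest components equal to those of \<open>f(x*)\<close>,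
  and let \<open>I\<close> index these components: no point of the section at \<open>x\<^sub>0\<close> can lower any of them.
\<close>

lemma weak_Pareto_constant_section:
  fixes f :: "'a \<Rightarrow> real ^ 's"
  assumes "weak_Pareto K f x"
  obtains I x0 where "I \<noteq> {}" and "x0 \<in> K"
    and "\<And>z i. z \<in> section_at K f x0 \<Longrightarrow> i \<in> I \<Longrightarrow> f z $ i = f x0 $ i"
proof -
  define A where "A z = {i. f z $ i = f x $ i}" for z
  \<comment> \<open>An empty \<open>A z\<close> would mean that \<open>z\<close> beats
    \<open>x\<close> strictly in every component.\<close>
  have A_ne: "A z \<noteq> {}" if "z \<in> section_at K f x" for z
    using that assms by (auto simp: A_def section_at_def weak_Pareto_def order_less_le)
  have "x \<in> section_at K f x" using assms by (simp add: section_at_def weak_Pareto_def)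
  then obtain x0 where x0: "x0 \<in> section_at K f x"
    and least: "\<And>z. z \<in> section_at K f x \<Longrightarrow> card (A x0) \<le> card (A z)"
    using ex_has_least_nat[of "\<lambda>z. z \<in> section_at K f x" x "\<lambda>z. card (A z)"] by blast
  show thesis
  proof
    show "A x0 \<noteq> {}" using A_ne[OF x0] .
    show "x0 \<in> K" using x0 by (simp add: section_at_def)
    fix z i assume z: "z \<in> section_at K f x0" and i: "i \<in> A x0"
    have "z \<in> section_at K f x" using z x0 by (auto simp: section_at_def intro: order_trans)
    \<comment> \<open>A component of \<open>z\<close> equal to that of \<open>x\<close> squeezes the
      one of \<open>x0\<close> between them; minimal cardinality then makes the two sets
      coincide.\<close>
    moreover have "A z \<subseteq> A x0"
    proof
      fix j assume "j \<in> A z"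
      moreover have "f z $ j \<le> f x0 $ j" "f x0 $ j \<le> f x $ j"
        using z x0 by (auto simp: section_at_def)
      ultimately show "j \<in> A x0" by (simp add: A_def)
    qed
    ultimately have "A z = A x0" using least[of z] by (intro card_seteq) auto
    with i show "f z $ i = f x0 $ i" by (auto simp: A_def)
  qed
qed

text \<open>Where \<open>g I\<close> is constant on the section, \<open>g I x0\<close> is the only
  possible limit value, and it is critical because \<open>x0\<close> trivially minimizes the sum.
  The union yields all three inclusions from one choice of \<open>I\<close> and
  \<open>x0\<close>.\<close>

lemma asymptotic_inclusions_if_weak_Pareto:
  fixes f :: "'a::euclidean_space \<Rightarrow> real ^ 's" and K :: "'a set"
  defines "g \<equiv> subvector f" and "C \<equiv> section_at K f"
  assumes f: "locally_lipschitz f" and K: "closed K" and "weak_Pareto K f x"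
  obtains I x0 where "I \<noteq> {}" and "x0 \<in> K" and "weakly_section_bounded K f I x0"
    and "K_tilde_inf I (g I) (C x0) (g I x0) \<union> K_inf I (g I) (C x0) (g I x0) \<union>
      T_inf I (g I) (C x0) (g I x0) \<subseteq> K_zero I (g I) (C x0) (g I x0)"
proof -
  obtain I x0 where I: "I \<noteq> {}" and x0: "x0 \<in> K"
    and const: "\<And>z i. z \<in> C x0 \<Longrightarrow> i \<in> I \<Longrightarrow> f z $ i = f x0 $ i"
    using weak_Pareto_constant_section[OF assms(5)] unfolding C_def by metis
  have x0C: "x0 \<in> C x0" using x0 by (simp add: C_def section_at_def)
  have g_const: "g I z = g I x0" if "z \<in> C x0" for z
    using const[OF that] by (auto simp: g_def subvector_def)
  have g_ext: "g I z \<in> I \<rightarrow>\<^sub>E UNIV" for z by (simp add: g_def subvector_def)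
  have closed: "closed (C x0)" unfolding C_def by (rule closed_section_at[OF f K])
  \<comment> \<open>The Fermat rule is applied with zero smooth part, so its multipliers sum to zero
    and \<open>rabier\<close> vanishes at \<open>x0\<close>.\<close>
  have "((\<lambda>_. 0) has_derivative (\<lambda>h. (0 :: 'a) \<bullet> h)) (at z)" for z :: 'a
    by simp
  moreover have "(\<Sum>i\<in>I. f x0 $ i) + 0 \<le> (\<Sum>i\<in>I. f u $ i) + 0" if "u \<in> C x0" for u
    using const[OF that] by simp
  ultimately have "\<exists>v \<omega>. (\<forall>i\<in>I. v i \<in> subdiff (\<lambda>z. g I z i) x0) \<and>
      \<omega> \<in> normal_cone x0 (C x0) \<and> (\<Sum>i\<in>I. v i) + 0 + \<omega> = 0"
    unfolding g_def by (rule Fermat_rule_subvector[OF f closed x0C _ continuous_const])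
  then obtain v \<omega> where v: "\<And>i. i \<in> I \<Longrightarrow> v i \<in> subdiff (\<lambda>z. g I z i) x0"
    and \<omega>: "\<omega> \<in> normal_cone x0 (C x0)" and eq: "(\<Sum>i\<in>I. v i) + 0 + \<omega> = 0"
    by blast
  have "rabier I (g I) (C x0) x0 = 0"
    using rabier_bounds[of I v "g I" x0 \<omega> "C x0"] v \<omega> I eq by simp
  then have zero: "g I x0 \<in> K_zero I (g I) (C x0) (g I x0)"
    unfolding K_zero_def using x0C by blast
  have limit: "y = g I x0" if "y \<in> I \<rightarrow>\<^sub>E UNIV" "\<And>k. X k \<in> C x0" "\<forall>i\<in>I. (\<lambda>k. g I (X k) i) \<longlonglongrightarrow> y i"
    for X :: "nat \<Rightarrow> 'a" and y
  proof (rule PiE_ext[OF that(1) g_ext])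
    fix i assume "i \<in> I"
    with that(3) have "(\<lambda>k. g I x0 i) \<longlonglongrightarrow> y i" by (simp add: g_const[OF that(2)])
    then show "y i = g I x0 i" by (simp add: LIMSEQ_const_iff)
  qed
  show thesis
  proof
    show "weakly_section_bounded K f I x0"
      unfolding weakly_section_bounded_def
      using g_const g_ext[of x0] by (intro bexI[of _ "g I x0"]) (auto simp: g_def C_def)
    show "K_tilde_inf I (g I) (C x0) (g I x0) \<union> K_inf I (g I) (C x0) (g I x0) \<union>
      T_inf I (g I) (C x0) (g I x0) \<subseteq> K_zero I (g I) (C x0) (g I x0)"
    proof
      fix y assume "y \<in> K_tilde_inf I (g I) (C x0) (g I x0) \<union> K_inf I (g I) (C x0) (g I x0) \<union>
        T_inf I (g I) (C x0) (g I x0)"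
      then obtain X :: "nat \<Rightarrow> 'a" where "y \<in> I \<rightarrow>\<^sub>E UNIV" "\<And>k. X k \<in> C x0"
        "\<forall>i\<in>I. (\<lambda>k. g I (X k) i) \<longlonglongrightarrow> y i"
        unfolding K_tilde_inf_def K_inf_def T_inf_def tangency_variety_def by blast
      from limit[OF this] zero show "y \<in> K_zero I (g I) (C x0) (g I x0)" by simp
    qed
  qed (use I x0 in auto)
qed

theorem theorem5p2:
  fixes f :: "real ^ 'n \<Rightarrow> real ^ 's" and K :: "(real ^ 'n) set"
  assumes "locally_lipschitz f" and "closed K" and "K \<noteq> {}"
  shows
    "((\<exists>x. weak_Pareto K f x) \<longleftrightarrow>
      (\<exists>I x0. I \<noteq> {} \<and> x0 \<in> K \<and> weakly_section_bounded K f I x0 \<and>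
        K_tilde_inf I (subvector f I) (section_at K f x0) (subvector f I x0)
          \<subseteq> K_zero I (subvector f I) (section_at K f x0) (subvector f I x0))) \<and>
     ((\<exists>x. weak_Pareto K f x) \<longleftrightarrow>
      (\<exists>I x0. I \<noteq> {} \<and> x0 \<in> K \<and> weakly_section_bounded K f I x0 \<and>
        K_inf I (subvector f I) (section_at K f x0) (subvector f I x0)
          \<subseteq> K_zero I (subvector f I) (section_at K f x0) (subvector f I x0))) \<and>
     ((\<exists>x. weak_Pareto K f x) \<longleftrightarrow>
      (\<exists>I x0. I \<noteq> {} \<and> x0 \<in> K \<and> weakly_section_bounded K f I x0 \<and>
        T_inf I (subvector f I) (section_at K f x0) (subvector f I x0)
          \<subseteq> K_zero I (subvector f I) (section_at K f x0) (subvector f I x0)))"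
proof -
  have "\<exists>I x0. I \<noteq> {} \<and> x0 \<in> K \<and> weakly_section_bounded K f I x0 \<and>
      K_tilde_inf I (subvector f I) (section_at K f x0) (subvector f I x0) \<union>
      K_inf I (subvector f I) (section_at K f x0) (subvector f I x0) \<union>
      T_inf I (subvector f I) (section_at K f x0) (subvector f I x0)
        \<subseteq> K_zero I (subvector f I) (section_at K f x0) (subvector f I x0)"
    if "\<exists>x. weak_Pareto K f x"
  proof -
    obtain x where "weak_Pareto K f x" using \<open>\<exists>x. weak_Pareto K f x\<close> ..
    then show ?thesis
      by (rule asymptotic_inclusions_if_weak_Pareto[OF assms(1,2)]) blast
  qed
  moreover have "\<exists>x. weak_Pareto K f x"
    if "I \<noteq> {}" "x0 \<in> K" "weakly_section_bounded K f I x0"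
      "K_tilde_inf I (subvector f I) (section_at K f x0) (subvector f I x0) \<inter>
      K_inf I (subvector f I) (section_at K f x0) (subvector f I x0) \<inter>
      T_inf I (subvector f I) (section_at K f x0) (subvector f I x0)
        \<subseteq> K_zero I (subvector f I) (section_at K f x0) (subvector f I x0)" for I x0
    using weak_Pareto_if_asymptotic_inclusion[OF assms(1,2) that(2,1,3,4)] .
  \<comment> \<open>Each asymptotic set lies between the intersection and the union, so the two
    implications give all three equivalences.\<close>
  ultimately show ?thesis
    unfolding Un_subset_iff by (meson Int_lower1 Int_lower2 subset_trans)
qed

end
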